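(* Let $G$ be a finite group such that the Chermak-Delgado measure $m_G$ takes exactly two distinct values on the set of subgroups of $G$. Then $G$ is a $p$-group for some prime $p$.
   Context: For a finite group $G$ and a subgroup $H\leq G$, the Chermak-Delgado measure of $H$ is $m_G(H)=|H|\,|C_G(H)|$, where $C_G(H)$ is the centralizer of $H$ in $G$. It is regarded as a function $m_G$ from the set $L(G)$ of all subgroups of $G$ to the positive integers. *)

theory Defs
  imports "HOL-Algebra.Coset" "HOL-Computational_Algebra.Primes"
begin

definition centralizer :: "('a, 'b) monoid_scheme \<Rightarrow> 'a set \<Rightarrow> 'a set" where
  "centralizer G H = {g \<in> carrier G. \<forall>h\<in>H. g \<otimes>\<^bsub>G\<^esub> h = h \<otimes>\<^bsub>G\<^esub> g}"

text \<open>Only meaningful for a subgroup \<open>H\<close> of a finite group \<open>G\<close>.\<close>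

definition cd_measure :: "('a, 'b) monoid_scheme \<Rightarrow> 'a set \<Rightarrow> nat" where
  "cd_measure G H = card H * card (centralizer G H)"

text \<open>The usual notion for finite groups; primality of \<open>p\<close> is part of the definition, and the
  trivial group is a \<open>p\<close>-group for every prime \<open>p\<close>.\<close>

definition finite_p_group :: "nat \<Rightarrow> ('a, 'b) monoid_scheme \<Rightarrow> bool" where
  "finite_p_group p G \<longleftrightarrow>
     group G \<and> finite (carrier G) \<and> prime p \<and> (\<exists>n. order G = p ^ n)"

end

theory Submission
  imports Defs "HOL-Algebra.Sylow" "HOL-Algebra.Group_Action"
begin

text \<open>
  The \<open>p\<close>-part of the Chermak-Delgado measure separates Sylow subgroups for different primes.
  Let \<open>p\<close> be a prime divisor of \<open>|G|\<close>, let \<open>p ^ a\<close> be the \<open>p\<close>-part of \<open>|G|\<close>, and let \<open>P\<close> be a Sylow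
  \<open>p\<close>-subgroup. Counting the fixed points of \<open>P\<close> acting on \<open>G\<close> by conjugation shows that
  \<open>p\<close> divides \<open>|C\<^sub>G(P)|\<close>, so \<open>p ^ (a + 1)\<close> divides \<open>m\<^sub>G(P)\<close> (\<open>sylow_measure_large_p_part\<close>).
  If the order of \<open>H\<close> is coprime to \<open>p\<close>, however, the \<open>p\<close>-part of \<open>m\<^sub>G(H)\<close> is that of
  \<open>|C\<^sub>G(H)|\<close>, which divides \<open>|G|\<close>, so \<open>p ^ (a + 1)\<close> does not divide \<open>m\<^sub>G(H)\<close>
  (\<open>coprime_measure_small_p_part\<close>).

  If two distinct primes \<open>p\<close> and \<open>q\<close> divided \<open>|G|\<close>, then comparing the trivial subgroup, a Sylow
  \<open>p\<close>-subgroup and a Sylow \<open>q\<close>-subgroup in this way would give three distinct values of \<open>m\<^sub>G\<close>.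
\<close>

text \<open>
  By the orbit-stabilizer theorem an orbit of a \<open>p\<close>-group has \<open>p\<close>-power size. An orbit that is not a
  single fixed point therefore has size divisible by \<open>p\<close>, and these orbits partition the set of
  points that are not fixed.
\<close>

lemma (in group_action) prime_dvd_card_non_fixed_points:
  assumes "prime p" and ord: "order G = p ^ n" and fin: "finite E"
  shows "p dvd card (E - {x \<in> E. \<forall>g\<in>carrier G. \<phi> g x = x})"
proof -
  define N where "N = {orb \<in> orbits G E \<phi>. card orb \<noteq> 1}"
  have fixed_orbit: "orbit G \<phi> x = {x}" if "x \<in> E" "\<forall>g\<in>carrier G. \<phi> g x = x" for x
    using orbit_refl[OF that(1)] that(2) by (auto simp: orbit_def)
  have orbit_fin: "finite (orbit G \<phi> x)" if "x \<in> E" for x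
    using fin that element_image by (auto simp: orbit_def intro: finite_subset)
  have "\<Union> N = E - {x \<in> E. \<forall>g\<in>carrier G. \<phi> g x = x}" (is "_ = E - ?F")
  proof
    show "\<Union> N \<subseteq> E - ?F"
    proof
      fix y assume "y \<in> \<Union> N"
      then obtain orb where orb: "orb \<in> orbits G E \<phi>" "card orb \<noteq> 1" "y \<in> orb"
        by (auto simp: N_def)
      then have yE: "y \<in> E" using orbits_coverture by blast
      then have "orbit G \<phi> y = orb"
        using disjoint_union[of "orbit G \<phi> y" orb] orb orbit_refl by (auto simp: orbits_def)
      then have "\<not> (\<forall>g\<in>carrier G. \<phi> g y = y)"
        using orb(2) fixed_orbit[OF yE] by (metis is_singletonI is_singleton_altdef)
      with yE show "y \<in> E - ?F" by blast
    qed
    show "E - ?F \<subseteq> \<Union> N"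
    proof
      fix x assume "x \<in> E - ?F"
      then obtain g where x: "x \<in> E" "g \<in> carrier G" "\<phi> g x \<noteq> x" by blast
      have "\<phi> g x \<in> orbit G \<phi> x" using x(2) by (auto simp: orbit_def)
      then have "card (orbit G \<phi> x) \<noteq> 1"
        using orbit_refl[OF x(1)] x(3) by (metis card_1_singletonE singletonD)
      then show "x \<in> \<Union> N" using orbit_refl[OF x(1)] x(1) by (auto simp: N_def orbits_def)
    qed
  qed
  moreover have "p dvd card (\<Union> N)"
  proof (rule dvd_partition)
    show "finite (\<Union> N)" using calculation fin by simp
    show "\<forall>orb\<in>N. p dvd card orb"
    proof
      fix orb assume "orb \<in> N"
      then obtain x where x: "x \<in> E" "orb = orbit G \<phi> x" "card orb \<noteq> 1"
        by (auto simp: N_def orbits_def)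
      have "card orb dvd p ^ n"
        using orbit_stabilizer_theorem[OF x(1)] x(2) ord by (metis dvd_triv_left)
      then obtain i where "card orb = p ^ i" using \<open>prime p\<close> divides_primepow_nat by blast
      with x(3) show "p dvd card orb" by (cases i) auto
    qed
    show "\<forall>c1\<in>N. \<forall>c2\<in>N. c1 \<noteq> c2 \<longrightarrow> c1 \<inter> c2 = {}"
      using disjoint_union by (auto simp: N_def)
  qed
  ultimately show ?thesis by simp
qed

text \<open>The fixed points of the conjugation action of \<open>H\<close> on \<open>G\<close> are the elements of \<open>C\<^sub>G(H)\<close>.\<close>

lemma (in group) prime_dvd_card_centralizer:
  assumes fin: "finite (carrier G)" and "prime p" and "p dvd order G"
    and H: "subgroup H G" and card: "card H = p ^ n"
  shows "p dvd card (centralizer G H)"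
proof -
  let ?\<phi> = "\<lambda>g. \<lambda>h\<in>carrier G. g \<otimes> h \<otimes> inv g"
  interpret conj: group_action "G\<lparr>carrier := H\<rparr>" "carrier G" ?\<phi>
    using group_action.induced_action[OF action_by_conjugation H] .
  have fixed: "{x \<in> carrier G. \<forall>g\<in>carrier (G\<lparr>carrier := H\<rparr>). ?\<phi> g x = x} = centralizer G H"
  proof -
    have "g \<otimes> x \<otimes> inv g = x \<longleftrightarrow> x \<otimes> g = g \<otimes> x" if "x \<in> carrier G" "g \<in> H" for x g
      using that subgroup.mem_carrier[OF H] inv_solve_right' by (metis inv_closed m_closed)
    then show ?thesis unfolding centralizer_def by auto
  qed
  have "p dvd card (carrier G - centralizer G H)"
    using conj.prime_dvd_card_non_fixed_points[OF \<open>prime p\<close> _ fin, of n] card fixed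
    by (simp add: order_def)
  moreover have "centralizer G H \<subseteq> carrier G" by (auto simp: centralizer_def)
  then have "order G = card (carrier G - centralizer G H) + card (centralizer G H)"
    using fin by (metis order_def card_Diff_subset card_mono finite_subset le_add_diff_inverse2)
  ultimately show ?thesis using \<open>p dvd order G\<close> by (metis dvd_add_right_iff)
qed

lemma (in group) subgroup_centralizer:
  assumes "H \<subseteq> carrier G"
  shows "subgroup (centralizer G H) G"
proof
  show "centralizer G H \<subseteq> carrier G" by (auto simp: centralizer_def)
  show "\<one> \<in> centralizer G H" using assms by (auto simp: centralizer_def)
  show "x \<otimes> y \<in> centralizer G H" if "x \<in> centralizer G H" "y \<in> centralizer G H" for x y
  proof -
    have "x \<otimes> y \<otimes> h = h \<otimes> (x \<otimes> y)" if "h \<in> H" for h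
      using that assms \<open>x \<in> _\<close> \<open>y \<in> _\<close> unfolding centralizer_def
      by (smt (verit) m_assoc mem_Collect_eq subsetD)
    then show ?thesis using that by (auto simp: centralizer_def)
  qed
  show "inv x \<in> centralizer G H" if "x \<in> centralizer G H" for x
  proof -
    have "inv x \<otimes> h = h \<otimes> inv x" if "h \<in> H" for h
      using that assms \<open>x \<in> _\<close> unfolding centralizer_def
      by (smt (verit) inv_closed inv_solve_left inv_solve_right' m_assoc m_closed mem_Collect_eq subsetD)
    then show ?thesis using that by (auto simp: centralizer_def)
  qed
qed

text \<open>One factor \<open>p\<close> beyond \<open>|P|\<close> comes from the centralizer.\<close>

lemma (in group) sylow_measure_large_p_part:
  assumes "finite (carrier G)" and "prime p" and "p dvd order G"
    and "subgroup P G" and "card P = p ^ a"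
  shows "p ^ Suc a dvd cd_measure G P"
  using prime_dvd_card_centralizer[OF assms] assms(5)
  by (simp add: cd_measure_def mult.commute mult_dvd_mono)

text \<open>
  All factors \<open>p\<close> of \<open>m\<^sub>G(H)\<close> come from \<open>|C\<^sub>G(H)|\<close>, which Lagrange's theorem bounds. The trivial
  subgroup and the Sylow subgroups for other primes are the cases of interest.
\<close>

lemma (in group) coprime_measure_small_p_part:
  assumes "\<not> p ^ k dvd order G" and H: "subgroup H G" and "coprime (card H) p"
  shows "\<not> p ^ k dvd cd_measure G H"
proof
  assume "p ^ k dvd cd_measure G H"
  then have "p ^ k dvd card (centralizer G H)"
    using \<open>coprime (card H) p\<close>
    by (simp add: cd_measure_def coprime_dvd_mult_right_iff coprime_commute)
  also have "card (centralizer G H) dvd order G"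
    using lagrange[OF subgroup_centralizer[OF subgroup.subset[OF H]]] by (metis dvd_triv_right)
  finally show False using assms(1) by contradiction
qed

lemma (in group) exists_sylow_subgroup:
  assumes fin: "finite (carrier G)" and "prime p"
  obtains P a where "subgroup P G" "card P = p ^ a" "\<not> p ^ Suc a dvd order G"
proof -
  have "order G \<noteq> 0" using fin order_gt_0_iff_finite by simp
  then obtain a m where m: "order G = p ^ a * m" "\<not> p dvd m"
    using \<open>prime p\<close> by (metis multiplicity_decompose' not_prime_unit)
  obtain P where P: "subgroup P G" "card P = p ^ a"
    using sylow_thm[OF \<open>prime p\<close> is_group m(1) fin] by blast
  have "\<not> p ^ Suc a dvd order G"
    using m \<open>prime p\<close> by (simp add: mult.commute[of p] prime_gt_0_nat)
  with P show thesis by (rule that)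
qed

lemma (in group) two_primes_imp_three_measures:
  assumes fin: "finite (carrier G)" and p: "prime p" "p dvd order G"
    and q: "prime q" "q dvd order G" and "p \<noteq> q"
  shows "3 \<le> card (cd_measure G ` {H. subgroup H G})"
proof -
  obtain P a where P: "subgroup P G" "card P = p ^ a" "\<not> p ^ Suc a dvd order G"
    by (rule exists_sylow_subgroup[OF fin p(1)])
  obtain Q b where Q: "subgroup Q G" "card Q = q ^ b" "\<not> q ^ Suc b dvd order G"
    by (rule exists_sylow_subgroup[OF fin q(1)])
  have "coprime p q" using primes_coprime[OF p(1) q(1) \<open>p \<noteq> q\<close>] .
  then have cop: "coprime (card Q) p" "coprime (card P) q"
    using P(2) Q(2) by (simp_all add: coprime_commute)
  note largeP = sylow_measure_large_p_part[OF fin p P(1,2)]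
  note largeQ = sylow_measure_large_p_part[OF fin q Q(1,2)]
  let ?m = "cd_measure G"
  have "?m P \<noteq> ?m Q"
    using largeP coprime_measure_small_p_part[OF P(3) Q(1) cop(1)] by metis
  moreover have "?m P \<noteq> ?m {\<one>}"
    using largeP coprime_measure_small_p_part[OF P(3) triv_subgroup] by auto
  moreover have "?m Q \<noteq> ?m {\<one>}"
    using largeQ coprime_measure_small_p_part[OF Q(3) triv_subgroup] by auto
  ultimately have "card {?m P, ?m Q, ?m {\<one>}} = 3" by simp
  moreover have "finite {H. subgroup H G}"
    using fin by (auto intro: finite_subset[of _ "Pow (carrier G)"] dest: subgroup.subset)
  then have "card {?m P, ?m Q, ?m {\<one>}} \<le> card (?m ` {H. subgroup H G})"
    using P(1) Q(1) triv_subgroup by (intro card_mono finite_imageI) auto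
  ultimately show ?thesis by simp
qed

theorem corollary2p3:
  fixes G :: "('a, 'b) monoid_scheme"
  assumes "group G" and "finite (carrier G)"
    and "card (cd_measure G ` {H. subgroup H G}) = 2"
  shows "\<exists>p. finite_p_group p G"
proof -
  interpret group G by fact
  have same: "p = q" if "prime p" "p dvd order G" "prime q" "q dvd order G" for p q
    using two_primes_imp_three_measures[OF assms(2) that] assms(3) by fastforce
  have "\<exists>p n. prime p \<and> order G = p ^ n"
  proof (cases "order G = 1")
    case True
    then have "order G = 2 ^ 0" by simp
    then show ?thesis using two_is_prime_nat by blast
  next
    case False
    then obtain p where p: "prime p" "p dvd order G" using prime_factor_nat by blast
    have "order G \<noteq> 0" using assms(2) order_gt_0_iff_finite by simp
    then obtain n m where m: "order G = p ^ n * m" "\<not> p dvd m"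
      using p(1) by (metis multiplicity_decompose' not_prime_unit)
    have "m = 1"
    proof (rule ccontr)
      assume "m \<noteq> 1"
      then obtain q where q: "prime q" "q dvd m" using prime_factor_nat by blast
      then have "q dvd order G" by (subst m(1)) simp
      with same[OF p q(1)] m(2) q(2) show False by simp
    qed
    with m(1) p(1) show ?thesis by auto
  qed
  then show ?thesis using assms(1,2) by (auto simp: finite_p_group_def)
qed

end
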